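(* Let $\Gamma\in(1,2]$ and let $n\in\mathbb R^2$ be a unit vector. Let $U^{-},U^{+}\in\mathcal G$ be two admissible states of the two-dimensional special relativistic hydrodynamics system, and let the wave speeds in direction $n$ be $$s^{-}=\min\big(s_{\min}(U^{-}),s_{\min}(U^{+})\big),\qquad s^{+}=\max\big(s_{\max}(U^{-}),s_{\max}(U^{+})\big).$$ Then the two intermediate states $U^{\ast,-}$ and $U^{\ast,+}$ produced by the HLLC Riemann solver in direction $n$ from $U^{-},U^{+}$ satisfy $U^{\ast,-}\in\mathcal G$ and $U^{\ast,+}\in\mathcal G$.
   Context: Units are such that the speed of light is $1$; $\Gamma\in(1,2]$ is the adiabatic index. Admissible states. For $\rho>0$, $p>0$ and $\mathbf u\in\mathbb R^2$ with $|\mathbf u|<1$ put $\gamma=(1-|\mathbf u|^2)^{-1/2}$, $h=1+\frac{\Gamma p}{(\Gamma-1)\rho}$, $D=\rho\gamma$, $\mathbf m=Dh\gamma\mathbf u$, $E=Dh\gamma-p$. The admissible set $\mathcal G\subset\mathbb R^4$ is the set of all $U=(D,\mathbf m,E)^T$ arising in this way (i.e. whose density, pressure and velocity satisfy $\rho>0$, $p>0$, $|\mathbf u|<1$); the primitive variables $(\rho,\mathbf u,p)$ are determined by $U\in\mathcal G$. Superscripts $\pm$ on these quantities refer to the states $U^{\pm}$. Directions and wave speeds. Let $\tau$ be a unit vector orthogonal to $n$; $m_n=\mathbf m\cdot n$, $m_\tau=\mathbf m\cdot\tau$, $u_n=\mathbf u\cdot n=m_n/(E+p)$. With $c_s=\sqrt{\Gamma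 p/(\rho h)}$ and $\sigma_s=\dfrac{c_s^2}{\gamma^2(1-c_s^2)}$, $$s_{\min}(U)=\frac{u_n-\sqrt{\sigma_s(1-u_n^2+\sigma_s)}}{1+\sigma_s},\qquad s_{\max}(U)=\frac{u_n+\sqrt{\sigma_s(1-u_n^2+\sigma_s)}}{1+\sigma_s}.$$ HLLC solver. Given $U^{\pm}\in\mathcal G$ and $s^{\pm}$, set $A^{\pm}=s^{\pm}E^{\pm}-m_n^{\pm}$, $B^{\pm}=m_n^{\pm}(s^{\pm}-u_n^{\pm})-p^{\pm}$, $\mathcal C_0=B^{+}-B^{-}$, $\mathcal C_1=A^{-}+s^{+}B^{-}-A^{+}-s^{-}B^{+}$, $\mathcal C_2=s^{-}A^{+}-s^{+}A^{-}$. The contact speed is the root $s^{\ast}=\frac{-\mathcal C_1-\sqrt{\mathcal C_1^2-4\mathcal C_0\mathcal C_2}}{2\mathcal C_2}$ of $\mathcal C_0+\mathcal C_1s+\mathcal C_2s^2=0$ (the root chosen because the wave speed should be less than $1$ in modulus; if $\mathcal C_2=0$, the root $-\mathcal C_0/\mathcal C_1$ of the linear equation), and $p^{\ast}=\frac{s^{\ast}A^{-}-B^{-}}{1-s^{-}s^{\ast}}=\frac{s^{\ast}A^{+}-B^{+}}{1-s^{+}s^{\ast}}$. The intermediate states $U^{\ast,\pm}=(D^{\ast,\pm},\mathbf m^{\ast,\pm},E^{\ast,\pm})^T$, with $\mathbf m^{\ast,\pm}=m_n^{\ast,\pm}n+m_\tau^{\ast,\pm}\tau$, are defined by $$D^{\ast,\pm}(s^{\pm}-s^{\ast})=D^{\pm}(s^{\pm}-u_n^{\pm}),\quad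 m_n^{\ast,\pm}(s^{\pm}-s^{\ast})=m_n^{\pm}(s^{\pm}-u_n^{\pm})+p^{\ast}-p^{\pm},$$ $$m_\tau^{\ast,\pm}(s^{\pm}-s^{\ast})=m_\tau^{\pm}(s^{\pm}-u_n^{\pm}),\quad E^{\ast,\pm}(s^{\pm}-s^{\ast})=E^{\pm}(s^{\pm}-u_n^{\pm})+p^{\ast}s^{\ast}-p^{\pm}u_n^{\pm}.$$ *)

theory Defs
  imports "HOL-Analysis.Analysis"
begin

text \<open>A state is the vector of conserved variables \<open>(D, m, E)\<close> of \<open>\<real>\<^sup>4\<close>, with the
  momentum kept as a vector of the plane.  The speed of light is 1.\<close>

type_synonym state = "real \<times> (real ^ 2) \<times> real"

definition mass :: "state \<Rightarrow> real" where "mass U = fst U"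
definition momentum :: "state \<Rightarrow> real ^ 2" where "momentum U = fst (snd U)"
definition energy :: "state \<Rightarrow> real" where "energy U = snd (snd U)"

definition lorentz :: "real ^ 2 \<Rightarrow> real" where
  "lorentz u = 1 / sqrt (1 - (norm u)\<^sup>2)"

definition enthalpy :: "real \<Rightarrow> real \<Rightarrow> real \<Rightarrow> real" where
  "enthalpy \<Gamma> \<rho> p = 1 + \<Gamma> * p / ((\<Gamma> - 1) * \<rho>)"

definition state_of_prim :: "real \<Rightarrow> real \<times> (real ^ 2) \<times> real \<Rightarrow> state" where
  "state_of_prim \<Gamma> = (\<lambda>(\<rho>, u, p).
     let \<gamma> = lorentz u; h = enthalpy \<Gamma> \<rho> p; D = \<rho> * \<gamma>
     in (D, (D * h * \<gamma>) *\<^sub>R u, D * h * \<gamma> - p))"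

definition physical :: "real \<times> (real ^ 2) \<times> real \<Rightarrow> bool" where
  "physical = (\<lambda>(\<rho>, u, p). \<rho> > 0 \<and> p > 0 \<and> norm u < 1)"

definition admissible :: "real \<Rightarrow> state set" where
  "admissible \<Gamma> = {U. \<exists>w. physical w \<and> U = state_of_prim \<Gamma> w}"

text \<open>The primitive variables \<open>(\<rho>, u, p)\<close> of an admissible state; the description is proper by
  \<open>prim_state_of_prim\<close> below.\<close>

definition prim :: "real \<Rightarrow> state \<Rightarrow> real \<times> (real ^ 2) \<times> real" where
  "prim \<Gamma> U = (THE w. physical w \<and> U = state_of_prim \<Gamma> w)"

definition rest_density :: "real \<Rightarrow> state \<Rightarrow> real" where
  "rest_density \<Gamma> U = fst (prim \<Gamma> U)"
definition velocity :: "real \<Rightarrow> state \<Rightarrow> real ^ 2" where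
  "velocity \<Gamma> U = fst (snd (prim \<Gamma> U))"
definition pressure :: "real \<Rightarrow> state \<Rightarrow> real" where
  "pressure \<Gamma> U = snd (snd (prim \<Gamma> U))"

definition normal_velocity :: "real \<Rightarrow> real ^ 2 \<Rightarrow> state \<Rightarrow> real" where
  "normal_velocity \<Gamma> n U = velocity \<Gamma> U \<bullet> n"

definition sound_speed :: "real \<Rightarrow> state \<Rightarrow> real" where
  "sound_speed \<Gamma> U =
     sqrt (\<Gamma> * pressure \<Gamma> U
       / (rest_density \<Gamma> U * enthalpy \<Gamma> (rest_density \<Gamma> U) (pressure \<Gamma> U)))"

definition sigma_s :: "real \<Rightarrow> state \<Rightarrow> real" where
  "sigma_s \<Gamma> U =
     (sound_speed \<Gamma> U)\<^sup>2 / ((lorentz (velocity \<Gamma> U))\<^sup>2 * (1 - (sound_speed \<Gamma> U)\<^sup>2))"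

definition s_min :: "real \<Rightarrow> real ^ 2 \<Rightarrow> state \<Rightarrow> real" where
  "s_min \<Gamma> n U = (let un = normal_velocity \<Gamma> n U; \<sigma> = sigma_s \<Gamma> U
     in (un - sqrt (\<sigma> * (1 - un\<^sup>2 + \<sigma>))) / (1 + \<sigma>))"

definition s_max :: "real \<Rightarrow> real ^ 2 \<Rightarrow> state \<Rightarrow> real" where
  "s_max \<Gamma> n U = (let un = normal_velocity \<Gamma> n U; \<sigma> = sigma_s \<Gamma> U
     in (un + sqrt (\<sigma> * (1 - un\<^sup>2 + \<sigma>))) / (1 + \<sigma>))"

text \<open>The HLLC solver.  Throughout, \<open>Um\<close>, \<open>Up\<close> and \<open>sm\<close>, \<open>sp\<close> are the states and the wave
  speeds with superscript minus and plus.\<close>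

definition hllc_A :: "real ^ 2 \<Rightarrow> real \<Rightarrow> state \<Rightarrow> real" where
  "hllc_A n s U = s * energy U - momentum U \<bullet> n"

definition hllc_B :: "real \<Rightarrow> real ^ 2 \<Rightarrow> real \<Rightarrow> state \<Rightarrow> real" where
  "hllc_B \<Gamma> n s U = (momentum U \<bullet> n) * (s - normal_velocity \<Gamma> n U) - pressure \<Gamma> U"

definition hllc_C0 :: "real \<Rightarrow> real ^ 2 \<Rightarrow> real \<Rightarrow> real \<Rightarrow> state \<Rightarrow> state \<Rightarrow> real" where
  "hllc_C0 \<Gamma> n sm sp Um Up = hllc_B \<Gamma> n sp Up - hllc_B \<Gamma> n sm Um"

definition hllc_C1 :: "real \<Rightarrow> real ^ 2 \<Rightarrow> real \<Rightarrow> real \<Rightarrow> state \<Rightarrow> state \<Rightarrow> real" where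
  "hllc_C1 \<Gamma> n sm sp Um Up =
     hllc_A n sm Um + sp * hllc_B \<Gamma> n sm Um - hllc_A n sp Up - sm * hllc_B \<Gamma> n sp Up"

definition hllc_C2 :: "real ^ 2 \<Rightarrow> real \<Rightarrow> real \<Rightarrow> state \<Rightarrow> state \<Rightarrow> real" where
  "hllc_C2 n sm sp Um Up = sm * hllc_A n sp Up - sp * hllc_A n sm Um"

definition contact_speed ::
    "real \<Rightarrow> real ^ 2 \<Rightarrow> real \<Rightarrow> real \<Rightarrow> state \<Rightarrow> state \<Rightarrow> real" where
  "contact_speed \<Gamma> n sm sp Um Up =
     (let C0 = hllc_C0 \<Gamma> n sm sp Um Up;
          C1 = hllc_C1 \<Gamma> n sm sp Um Up;
          C2 = hllc_C2 n sm sp Um Up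
      in if C2 = 0 then - C0 / C1 else (- C1 - sqrt (C1\<^sup>2 - 4 * C0 * C2)) / (2 * C2))"

text \<open>The contact pressure has one expression for each side.  The minus side serves as the
  definition; \<open>contact_pressure_plus\<close> below gives the other one.\<close>

definition contact_pressure ::
    "real \<Rightarrow> real ^ 2 \<Rightarrow> real \<Rightarrow> real \<Rightarrow> state \<Rightarrow> state \<Rightarrow> real" where
  "contact_pressure \<Gamma> n sm sp Um Up =
     (let ss = contact_speed \<Gamma> n sm sp Um Up
      in (ss * hllc_A n sm Um - hllc_B \<Gamma> n sm Um) / (1 - sm * ss))"

text \<open>The jump conditions across the wave of speed \<open>s\<close>, solved for the intermediate state, where
  \<open>ss\<close> and \<open>ps\<close> are the contact speed and pressure.  In the degenerate case \<open>s = ss\<close> the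
  value is the zero state, which is not admissible.\<close>

definition star_state ::
    "real \<Rightarrow> real ^ 2 \<Rightarrow> real ^ 2 \<Rightarrow> real \<Rightarrow> real \<Rightarrow> real \<Rightarrow> state \<Rightarrow> state" where
  "star_state \<Gamma> n \<tau> s ss ps U =
     (let un = normal_velocity \<Gamma> n U;
          p = pressure \<Gamma> U;
          mn = ((momentum U \<bullet> n) * (s - un) + ps - p) / (s - ss);
          mt = (momentum U \<bullet> \<tau>) * (s - un) / (s - ss)
      in (mass U * (s - un) / (s - ss),
          mn *\<^sub>R n + mt *\<^sub>R \<tau>,
          (energy U * (s - un) + ps * ss - p * un) / (s - ss)))"

definition hllc_minus ::
    "real \<Rightarrow> real ^ 2 \<Rightarrow> real ^ 2 \<Rightarrow> real \<Rightarrow> real \<Rightarrow> state \<Rightarrow> state \<Rightarrow> state" where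
  "hllc_minus \<Gamma> n \<tau> sm sp Um Up =
     star_state \<Gamma> n \<tau> sm (contact_speed \<Gamma> n sm sp Um Up) (contact_pressure \<Gamma> n sm sp Um Up) Um"

definition hllc_plus ::
    "real \<Rightarrow> real ^ 2 \<Rightarrow> real ^ 2 \<Rightarrow> real \<Rightarrow> real \<Rightarrow> state \<Rightarrow> state \<Rightarrow> state" where
  "hllc_plus \<Gamma> n \<tau> sm sp Um Up =
     star_state \<Gamma> n \<tau> sp (contact_speed \<Gamma> n sm sp Um Up) (contact_pressure \<Gamma> n sm sp Um Up) Up"


subsection \<open>Well-definedness\<close>

lemma contact_pressure_plus:
  assumes ss: "ss = contact_speed \<Gamma> n sm sp Um Up"
    and root: "hllc_C0 \<Gamma> n sm sp Um Up + hllc_C1 \<Gamma> n sm sp Um Up * ss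
                   + hllc_C2 n sm sp Um Up * ss\<^sup>2 = 0"
    and "1 - sm * ss \<noteq> 0" "1 - sp * ss \<noteq> 0"
  shows "contact_pressure \<Gamma> n sm sp Um Up
           = (ss * hllc_A n sp Up - hllc_B \<Gamma> n sp Up) / (1 - sp * ss)"
proof -
  have "(ss * hllc_A n sm Um - hllc_B \<Gamma> n sm Um) * (1 - sp * ss)
      = (ss * hllc_A n sp Up - hllc_B \<Gamma> n sp Up) * (1 - sm * ss)"
    using root unfolding hllc_C0_def hllc_C1_def hllc_C2_def
    by (simp add: algebra_simps power2_eq_square)
  then show ?thesis
    using assms(3,4) unfolding contact_pressure_def Let_def ss[symmetric]
    by (simp add: frac_eq_eq)
qed

lemma prim_facts:
  assumes G: "1 < \<Gamma>" and w: "physical (\<rho>, u, p)" and U: "(D, m, E) = state_of_prim \<Gamma> (\<rho>, u, p)"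
  shows "m = (E + p) *\<^sub>R u" "E + p > 0" "D > 0" "\<rho> = D * sqrt (1 - (norm u)\<^sup>2)"
    "(E + p) * (1 - (norm u)\<^sup>2) - D * sqrt (1 - (norm u)\<^sup>2) = \<Gamma> / (\<Gamma> - 1) * p"
proof -
  define q where "q = sqrt (1 - (norm u)\<^sup>2)"
  have pos: "\<rho> > 0" "p > 0" "norm u < 1" using w by (auto simp: physical_def)
  then have "(norm u)\<^sup>2 < 1" by (simp add: power_less_one_iff)
  then have q: "q > 0" "q\<^sup>2 = 1 - (norm u)\<^sup>2" by (auto simp: q_def)
  have D: "D = \<rho> / q" and E: "E + p = \<rho> * enthalpy \<Gamma> \<rho> p / q\<^sup>2" and m: "m = (E + p) *\<^sub>R u"
    using U unfolding state_of_prim_def Let_def lorentz_def q_def[symmetric] prod.case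
    by (auto simp: power2_eq_square)
  have h: "\<rho> * enthalpy \<Gamma> \<rho> p = \<rho> + \<Gamma> / (\<Gamma> - 1) * p" using pos G
    by (simp add: enthalpy_def field_simps)
  show "m = (E + p) *\<^sub>R u" by fact
  show "D > 0" using D q pos by simp
  have "\<rho> * enthalpy \<Gamma> \<rho> p > 0" unfolding h using pos G by (simp add: add_pos_pos)
  then show "E + p > 0" unfolding E using q(1) by simp
  show "\<rho> = D * sqrt (1 - (norm u)\<^sup>2)" using D q by (simp add: q_def[symmetric])
  show "(E + p) * (1 - (norm u)\<^sup>2) - D * sqrt (1 - (norm u)\<^sup>2) = \<Gamma> / (\<Gamma> - 1) * p"
    unfolding q_def[symmetric] q(2)[symmetric] E D using q(1) h by simp
qed

lemma prim_unique_aux: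
  assumes G: "1 < \<Gamma>" "\<Gamma> \<le> 2"
    and w: "physical (\<rho>, u, p)" "physical (\<rho>', u', p')"
    and U: "(D, m, E) = state_of_prim \<Gamma> (\<rho>, u, p)" "(D, m, E) = state_of_prim \<Gamma> (\<rho>', u', p')"
  shows "\<not> p < p'"
proof
  assume less: "p < p'"
  note f = prim_facts[OF G(1) w(1) U(1)] and f' = prim_facts[OF G(1) w(2) U(2)]
  define x x' a a' where "x = E + p" "x' = E + p'" "a = norm u" "a' = norm u'"
  note d = this
  have a: "0 \<le> a" "a < 1" "0 \<le> a'" "a' < 1" using w by (auto simp: d physical_def)
  have x: "0 < x" "x < x'" using f less by (auto simp: d)
  have m: "x * a = x' * a'" using f f' x
    by (metis abs_of_pos d norm_scaleR order.strict_trans)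
  have "x * a' \<le> x' * a'" using x a by (simp add: mult_right_mono)
  then have a'a: "a' \<le> a" using m x by (metis mult_le_cancel_left_pos)
  then have "a'\<^sup>2 \<le> a\<^sup>2" using a by (simp add: power_mono)
  then have sq: "D * sqrt (1 - a\<^sup>2) \<le> D * sqrt (1 - a'\<^sup>2)" using f by simp
  have "x * a\<^sup>2 - x' * a'\<^sup>2 = x' * a' * (a - a')"
    using m by (simp add: power2_eq_square algebra_simps)
  also have "\<dots> = a' * (x' * a - x' * a')" by (simp add: algebra_simps)
  also have "\<dots> = a' * a * (x' - x)" unfolding m[symmetric] by (simp add: algebra_simps)
  also have "\<dots> < 1 * (x' - x)"
  proof (rule mult_strict_right_mono)
    show "a' * a < 1" using a mult_strict_mono[of a' 1 a 1] by simp
  qed (use x in simp)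
  finally have lt: "x * a\<^sup>2 - x' * a'\<^sup>2 < x' - x" by simp
  have eqs: "x * (1 - a\<^sup>2) - D * sqrt (1 - a\<^sup>2) = \<Gamma> / (\<Gamma> - 1) * p"
    "x' * (1 - a'\<^sup>2) - D * sqrt (1 - a'\<^sup>2) = \<Gamma> / (\<Gamma> - 1) * p'" using f f' by (auto simp: d)
  have "\<Gamma> / (\<Gamma> - 1) * (p' - p) < 2 * (x' - x)"
    using eqs sq lt unfolding right_diff_distrib mult_1_right by linarith
  moreover have "x' - x = p' - p" by (simp add: d)
  moreover have "2 \<le> \<Gamma> / (\<Gamma> - 1)" using G by (simp add: field_simps)
  then have "2 * (p' - p) \<le> \<Gamma> / (\<Gamma> - 1) * (p' - p)" using less by (intro mult_right_mono) auto
  ultimately show False by simp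
qed

lemma prim_state_of_prim:
  assumes G: "1 < \<Gamma>" "\<Gamma> \<le> 2" and w: "physical w"
  shows "prim \<Gamma> (state_of_prim \<Gamma> w) = w"
  unfolding prim_def
proof (rule the_equality)
  fix v assume v: "physical v \<and> state_of_prim \<Gamma> w = state_of_prim \<Gamma> v"
  obtain \<rho> u p where w': "w = (\<rho>, u, p)" by (cases w) auto
  obtain \<rho>' u' p' where v': "v = (\<rho>', u', p')" by (cases v) auto
  obtain D m E where U: "(D, m, E) = state_of_prim \<Gamma> (\<rho>, u, p)"
    by (metis prod_cases3)
  have U': "(D, m, E) = state_of_prim \<Gamma> (\<rho>', u', p')" using U v w' v' by simp
  have p: "physical (\<rho>, u, p)" "physical (\<rho>', u', p')" using w v w' v' by auto
  have "p = p'"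
    using prim_unique_aux[OF G p U U'] prim_unique_aux[OF G p(2,1) U' U] by linarith
  moreover note f = prim_facts[OF G(1) p(1) U] and f' = prim_facts[OF G(1) p(2) U']
  ultimately have "(E + p) *\<^sub>R u = (E + p) *\<^sub>R u'" "E + p \<noteq> 0"
    using f(1,2) f'(1) by auto
  then have "u = u'" by simp
  then have "\<rho> = \<rho>'" using f(4) f'(4) by simp
  with \<open>p = p'\<close> \<open>u = u'\<close> show "v = w" by (simp add: w' v')
qed (use w in auto)

end

theory Submission
  imports Defs
begin

text \<open>An admissible state has \<open>D > 0\<close> and \<open>E > sqrt (D\<^sup>2 + |m|\<^sup>2)\<close>, and because \<open>\<Gamma> \<le> 2\<close> these
  two inequalities also suffice.  The quadratic \<open>C\<^sub>0 + C\<^sub>1 s + C\<^sub>2 s\<^sup>2\<close> is positive at \<open>s\<^sup>-\<close> and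
  negative at \<open>s\<^sup>+\<close>, so the contact speed lies strictly between the two.  After that each side can be
  treated on its own, for an arbitrary contact speed \<open>r\<close> with \<open>|r| < 1\<close> on the correct side of \<open>s\<close>:
  with \<open>P = A - s B\<close> and \<open>Q = s A - B\<close>, minimising over \<open>r\<close> the amount by which the inequality for \<open>E\<close>
  holds leaves \<open>P\<^sup>2 - Q\<^sup>2 > (1 - s\<^sup>2) (D\<^sup>2 + m\<^sub>\<tau>\<^sup>2) (s - u\<^sub>n)\<^sup>2\<close>.  This follows from
  \<open>(s - u\<^sub>n)\<^sup>2 \<ge> \<sigma>\<^sub>s (1 - s\<^sup>2)\<close>, which expresses that \<open>s\<close> is not strictly between \<open>s_min\<close> and
  \<open>s_max\<close>, and \<open>(a - 1) (a - 2) \<ge> 0\<close> for \<open>a = \<Gamma> / (\<Gamma> - 1)\<close>.  The contact pressure itself may be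
  negative.\<close>

section \<open>Admissibility from inequalities\<close>

text \<open>With velocity \<open>m / (E + p)\<close>, the equation of state becomes
  \<open>\<psi> p = 0\<close>. The hypothesis on \<open>E\<close> makes \<open>\<psi> 0\<close>
  positive, and \<psi> is negative at \<open>p1\<close>, so a positive pressure solves it.\<close>

lemma admissible_sufficient:
  assumes G: "1 < \<Gamma>" "\<Gamma> \<le> 2" and D: "D > 0" and E: "E > 0"
    and gt: "D\<^sup>2 + (norm m)\<^sup>2 < E\<^sup>2"
  shows "(D, m, E) \<in> admissible \<Gamma>"
proof -
  define a where "a = \<Gamma> / (\<Gamma> - 1)"
  have a: "a \<ge> 2" using G by (simp add: a_def field_simps)
  define M where "M = norm m"
  have "(norm m)\<^sup>2 < E\<^sup>2" using gt zero_less_power[OF D, of 2] by linarith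
  then have M: "M \<ge> 0" "M < E" using E by (auto simp: M_def intro: power2_less_imp_less)
  define \<psi> where "\<psi> p = (E + p) * (1 - (M / (E + p))\<^sup>2) - D * sqrt (1 - (M / (E + p))\<^sup>2) - a * p" for p
  have ratio: "0 \<le> M / (E + p)" "M / (E + p) < 1" "(M / (E + p))\<^sup>2 < 1" if "p \<ge> 0" for p
  proof -
    show *: "0 \<le> M / (E + p)" "M / (E + p) < 1" using M E that by (auto simp: field_simps)
    show "(M / (E + p))\<^sup>2 < 1" using power_strict_mono[OF *(2,1), of 2] by simp
  qed
  \<comment> \<open>Chosen so that \<open>E + p1 = a * p1\<close>: the first and last terms of
    \<psi> then cancel up to a nonpositive remainder.\<close>
  define p1 where "p1 = E / (a - 1)"
  have p1: "p1 > 0" "E + p1 = a * p1" using a E by (auto simp: p1_def field_simps)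
  have end1: "\<psi> p1 < 0"
  proof -
    define x where "x = E + p1"
    have x: "x = a * p1" "x > 0" using p1 E by (simp_all add: x_def)
    have "x * (1 - (M / x)\<^sup>2) \<le> x" using x(2) by (simp add: mult_le_cancel_left1)
    moreover have "D * sqrt (1 - (M / x)\<^sup>2) > 0" using D ratio[of p1] p1 by (simp add: x_def)
    ultimately show ?thesis unfolding \<psi>_def x_def[symmetric] x(1)[symmetric] by linarith
  qed
  have end0: "\<psi> 0 > 0"
  proof -
    define q where "q = sqrt (1 - (M / E)\<^sup>2)"
    have q: "q > 0" "q\<^sup>2 = 1 - (M / E)\<^sup>2" using ratio[of 0] by (auto simp: q_def)
    have "D\<^sup>2 < (E * q)\<^sup>2"
    proof -
      have "(E * q)\<^sup>2 = E\<^sup>2 - M\<^sup>2" unfolding power_mult_distrib q(2) using E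
        by (simp add: power_divide algebra_simps)
      then show ?thesis using gt by (simp add: M_def)
    qed
    then have "D < E * q" using E q by (intro power2_less_imp_less[of D]) auto
    then have "D * q < E * q * q" using q by simp
    moreover have "\<psi> 0 = E * q * q - D * q"
      unfolding \<psi>_def mult.assoc power2_eq_square[of q, symmetric] q(2) by (simp add: q_def)
    ultimately show ?thesis by simp
  qed
  have "continuous_on {0..p1} \<psi>"
    unfolding \<psi>_def using E by (intro continuous_intros) auto
  then obtain p where p: "0 \<le> p" "p \<le> p1" "\<psi> p = 0"
    using IVT2'[of \<psi> p1 0 0] end0 end1 p1 by auto
  have "p \<noteq> 0" using p end0 by auto
  then have p0: "p > 0" using p by simp
  define u where "u = (1 / (E + p)) *\<^sub>R m"
  define q where "q = sqrt (1 - (norm u)\<^sup>2)"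
  have nu: "norm u = M / (E + p)" using E p0 by (simp add: u_def M_def)
  have q: "q > 0" "q\<^sup>2 = 1 - (norm u)\<^sup>2" using ratio[of p] p0 by (auto simp: q_def nu)
  have eq: "(E + p) * q\<^sup>2 - D * q = a * p"
    using p(3) unfolding \<psi>_def nu[symmetric] q(2) by (simp add: q_def)
  have h: "D * q * enthalpy \<Gamma> (D * q) p = D * q + a * p"
    using D q G by (simp add: enthalpy_def a_def field_simps)
  have W: "D * q / q * enthalpy \<Gamma> (D * q) p / q = E + p"
  proof -
    have "q * (D * enthalpy \<Gamma> (D * q) p) = q * ((E + p) * q)" using h eq by algebra
    then have "D * enthalpy \<Gamma> (D * q) p = (E + p) * q" using q(1) by simp
    then show ?thesis using q(1) by simp
  qed
  have "state_of_prim \<Gamma> (D * q, u, p) = (D, m, E)"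
    using W q(1) E p0 unfolding state_of_prim_def Let_def lorentz_def q_def[symmetric] prod.case
    by (simp add: u_def)
  moreover have "physical (D * q, u, p)" using D q p0 ratio[of p] nu by (simp add: physical_def)
  ultimately show ?thesis unfolding admissible_def by force
qed

section \<open>Root selection and orthonormal coordinates\<close>

text \<open>If \<open>c2\<close> is nonzero, the slope at \<open>r\<close> is minus the square root
  of the discriminant. So \<open>r\<close> is the root where the quadratic falls through zero, for
  either sign of \<open>c2\<close>.\<close>

lemma quadratic_root_between:
  fixes a b c0 c1 c2 :: real
  assumes ab: "a < b" and fa: "c0 + c1 * a + c2 * a\<^sup>2 > 0" and fb: "c0 + c1 * b + c2 * b\<^sup>2 < 0"
  defines "r \<equiv> if c2 = 0 then - c0 / c1 else (- c1 - sqrt (c1\<^sup>2 - 4 * c0 * c2)) / (2 * c2)"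
  shows "a < r" "r < b" "c0 + c1 * r + c2 * r\<^sup>2 = 0"
proof -
  have "a < r \<and> r < b \<and> c0 + c1 * r + c2 * r\<^sup>2 = 0"
  proof (cases "c2 = 0")
    case True
    have "c1 * (b - a) < 0" using fa fb True by (simp add: algebra_simps)
    then have c1: "c1 < 0" using ab by (simp add: mult_less_0_iff)
    then show ?thesis using fa fb True by (simp add: r_def field_simps)
  next
    case False
    define d where "d = c1\<^sup>2 - 4 * c0 * c2"
    define r' where "r' = (- c1 + sqrt d) / (2 * c2)"
    have r: "r = (- c1 - sqrt d) / (2 * c2)" using False by (simp add: r_def d_def)
    have sq: "4 * c2 * (c0 + c1 * x + c2 * x\<^sup>2) = (2 * c2 * x + c1)\<^sup>2 - d" for x
      by (simp add: d_def algebra_simps power2_eq_square)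
    have d: "d > 0"
    proof (rule ccontr)
      assume "\<not> d > 0"
      then have "4 * c2 * (c0 + c1 * x + c2 * x\<^sup>2) \<ge> 0" for x unfolding sq
        using zero_le_power2[of "2 * c2 * x + c1"] by linarith
      then show False using False fa fb by (metis linorder_not_less
        mult_eq_0_iff order_antisym_conv zero_le_mult_iff zero_neq_numeral)
    qed
    have "r + r' = - c1 / c2" using False by (simp add: r r'_def field_simps)
    moreover have "r * r' = c0 / c2"
    proof -
      have "r * r' = (c1\<^sup>2 - (sqrt d)\<^sup>2) / (4 * c2\<^sup>2)"
        using False by (simp add: r r'_def field_simps power2_eq_square)
      also have "\<dots> = c0 / c2" using d False by (simp add: d_def field_simps power2_eq_square)
      finally show ?thesis .
    qed
    ultimately have "c1 = - (c2 * (r + r'))" "c0 = c2 * (r * r')" using False by (simp_all add: field_simps)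
    then have fact: "c0 + c1 * x + c2 * x\<^sup>2 = c2 * ((x - r) * (x - r'))" for x
      by algebra
    have root: "c0 + c1 * r + c2 * r\<^sup>2 = 0" unfolding fact by simp
    have diff: "c2 * (r' - r) > 0" using d False by (simp add: r r'_def field_simps)
    have "a < r \<and> r < b"
    proof (cases "c2 > 0")
      case True
      then have "r < r'" "(a - r) * (a - r') > 0" "(b - r) * (b - r') < 0"
        using diff fa fb unfolding fact by (auto simp: zero_less_mult_iff mult_less_0_iff)
      then show ?thesis using ab by (auto simp: zero_less_mult_iff mult_less_0_iff)
    next
      case False
      then have "r' < r" "(a - r) * (a - r') < 0" "(b - r) * (b - r') > 0"
        using diff fa fb \<open>c2 \<noteq> 0\<close> unfolding fact by (auto simp: zero_less_mult_iff mult_less_0_iff)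
      then show ?thesis using ab by (auto simp: zero_less_mult_iff mult_less_0_iff)
    qed
    with root show ?thesis by simp
  qed
  then show "a < r" "r < b" "c0 + c1 * r + c2 * r\<^sup>2 = 0" by auto
qed

lemma norm_orthonormal_2:
  fixes n \<tau> x :: "real ^ 2"
  assumes "norm n = 1" "norm \<tau> = 1" "\<tau> \<bullet> n = 0"
  shows "(norm x)\<^sup>2 = (x \<bullet> n)\<^sup>2 + (x \<bullet> \<tau>)\<^sup>2"
proof -
  have sq: "(norm y)\<^sup>2 = y$1 * y$1 + y$2 * y$2" for y :: "real ^ 2"
    by (simp add: power2_norm_eq_inner inner_vec_def sum_2)
  have "n$1 * n$1 + n$2 * n$2 = 1" "\<tau>$1 * \<tau>$1 + \<tau>$2 * \<tau>$2 = 1" "\<tau>$1 * n$1 + \<tau>$2 * n$2 = 0"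
    using assms sq[of n] sq[of \<tau>] by (simp_all add: inner_vec_def sum_2)
  then have "x$1 * x$1 + x$2 * x$2 = (x$1 * n$1 + x$2 * n$2)\<^sup>2 + (x$1 * \<tau>$1 + x$2 * \<tau>$2)\<^sup>2"
    by algebra
  then show ?thesis by (simp add: sq inner_vec_def sum_2)
qed

section \<open>One fluid state and one wave\<close>

text \<open>\<open>u\<close> and \<open>v\<close> are the normal and tangential velocities.  Below, \<open>c2\<close> is the squared sound speed,
  \<open>H = \<rho> h\<close>, \<open>g = 1 / \<gamma>\<^sup>2\<close>, \<open>W = E + p\<close> and \<open>K = D\<^sup>2 + m\<^sub>\<tau>\<^sup>2\<close>.\<close>

locale fluid =
  fixes \<Gamma> \<rho> p u v :: real
  assumes Gam: "1 < \<Gamma>" "\<Gamma> \<le> 2" and rho: "\<rho> > 0" and pr: "p > 0" and sub: "u\<^sup>2 + v\<^sup>2 < 1"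
begin

definition "H = \<rho> + \<Gamma> / (\<Gamma> - 1) * p"
definition "c2 = \<Gamma> * p / H"
definition "g = 1 - u\<^sup>2 - v\<^sup>2"
definition "W = H / g"
definition "\<sigma> = c2 * g / (1 - c2)"
definition "smin = (u - sqrt (\<sigma> * (1 - u\<^sup>2 + \<sigma>))) / (1 + \<sigma>)"
definition "smax = (u + sqrt (\<sigma> * (1 - u\<^sup>2 + \<sigma>))) / (1 + \<sigma>)"
text \<open>The solver's \<open>hllc_A\<close> and \<open>hllc_B\<close> in primitive variables: the
  energy is \<open>W - p\<close>, the normal momentum \<open>W * u\<close>.\<close>

definition "A s = s * (W - p) - W * u"
definition "B s = W * u * (s - u) - p"

section \<open>Sound speed and acoustic wave speeds\<close>

lemma basic: "H > 0" "g > 0" "W > 0" "W * g = H" "u\<^sup>2 < 1"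
proof -
  show H: "H > 0" using rho pr Gam by (simp add: H_def add_pos_pos)
  show g: "g > 0" using sub by (simp add: g_def)
  show "W > 0" "W * g = H" using H g by (simp_all add: W_def)
  show "u\<^sup>2 < 1" using sub zero_le_power2[of v] by linarith
qed

lemma u_bounds: "- 1 < u" "u < 1"
  using basic(5) by (auto simp: power2_less_1_iff abs_less_iff)

lemma c2: "0 < c2" "c2 < \<Gamma> - 1" "c2 * H = \<Gamma> * p" "c2 < 1"
proof -
  show 1: "0 < c2" using basic pr Gam by (simp add: c2_def)
  have "(\<Gamma> - 1) * H = (\<Gamma> - 1) * \<rho> + \<Gamma> * p" using Gam by (simp add: H_def field_simps)
  then have "\<Gamma> * p < (\<Gamma> - 1) * H" using Gam rho by simp
  then show 2: "c2 < \<Gamma> - 1" using basic by (simp add: c2_def pos_divide_less_eq)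
  show "c2 * H = \<Gamma> * p" using basic by (simp add: c2_def)
  show "c2 < 1" using 2 Gam by simp
qed

lemma \<sigma>: "\<sigma> > 0" "\<sigma> * (1 - c2) = c2 * g"
  using c2 basic by (simp_all add: \<sigma>_def)

text \<open>Multiplied by \<open>1 + \<sigma>\<close>, the left side is a difference of two squares
  that vanishes at the acoustic speeds.\<close>

lemma speed_factor: "(s - u)\<^sup>2 - \<sigma> * (1 - s\<^sup>2) = (1 + \<sigma>) * ((s - smin) * (s - smax))"
proof -
  define q where "q = sqrt (\<sigma> * (1 - u\<^sup>2 + \<sigma>))"
  have q: "q\<^sup>2 = \<sigma> * (1 - u\<^sup>2 + \<sigma>)" using \<sigma> basic by (simp add: q_def)
  have "(1 + \<sigma>) * smin = u - q" "(1 + \<sigma>) * smax = u + q"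
    using \<sigma> by (simp_all add: smin_def smax_def q_def)
  then have "(1 + \<sigma>) * ((1 + \<sigma>) * ((s - smin) * (s - smax)))
      = ((1 + \<sigma>) * s - (u - q)) * ((1 + \<sigma>) * s - (u + q))"
    by algebra
  also have "\<dots> = ((1 + \<sigma>) * s - u)\<^sup>2 - q\<^sup>2" by algebra
  also have "\<dots> = (1 + \<sigma>) * ((s - u)\<^sup>2 - \<sigma> * (1 - s\<^sup>2))" unfolding q by algebra
  finally show ?thesis using \<sigma> by (simp add: mult_left_cancel)
qed

lemma speed_sum: "(1 + \<sigma>) * (smin + smax) = 2 * u" "smin < smax"
proof -
  have "\<sigma> * (1 - u\<^sup>2 + \<sigma>) > 0" using \<sigma> basic by simp
  then show "smin < smax" using \<sigma> by (simp add: smin_def smax_def divide_strict_right_mono)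
  show "(1 + \<sigma>) * (smin + smax) = 2 * u"
    using \<sigma> by (simp add: smin_def smax_def add_divide_distrib[symmetric])
qed

text \<open>The quadratic of \<open>speed_factor\<close> is negative at \<open>u\<close> and
  positive at 1 and -1.\<close>

lemma speeds: "- 1 < smin" "smin < u" "u < smax" "smax < 1"
proof -
  have "(1 + \<sigma>) * ((u - smin) * (u - smax)) < 0"
    unfolding speed_factor[symmetric] using \<sigma> basic by simp
  then have "(u - smin) * (u - smax) < 0" using \<sigma> by (simp add: mult_less_0_iff)
  then show *: "smin < u" "u < smax" using speed_sum by (auto simp: mult_less_0_iff)
  have "(1 + \<sigma>) * ((1 - smin) * (1 - smax)) > 0"
    unfolding speed_factor[symmetric] using u_bounds by simp
  then have "(1 - smin) * (1 - smax) > 0" using \<sigma> by (simp add: zero_less_mult_iff)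
  then show "smax < 1" using * u_bounds by (auto simp: zero_less_mult_iff)
  have "(1 + \<sigma>) * ((- 1 - smin) * (- 1 - smax)) > 0"
    unfolding speed_factor[symmetric] using u_bounds by simp
  then have "(- 1 - smin) * (- 1 - smax) > 0" using \<sigma> by (simp add: zero_less_mult_iff)
  then show "- 1 < smin" using * u_bounds by (auto simp: zero_less_mult_iff)
qed

text \<open>Both HLLC wave speeds have this property for both states.\<close>

definition "outer s \<longleftrightarrow> - 1 < s \<and> s < 1 \<and> (s \<le> smin \<or> smax \<le> s)"

lemma outer: assumes "outer s"
  shows "\<sigma> * (1 - s\<^sup>2) \<le> (s - u)\<^sup>2" "s\<^sup>2 < 1" "s \<noteq> u" "1 - s * u > 0"
proof -
  have "(s - smin) * (s - smax) \<ge> 0"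
    using assms speed_sum by (auto simp: outer_def zero_le_mult_iff)
  then have "(1 + \<sigma>) * ((s - smin) * (s - smax)) \<ge> 0" using \<sigma> by simp
  then show "\<sigma> * (1 - s\<^sup>2) \<le> (s - u)\<^sup>2" unfolding speed_factor[symmetric] by simp
  show "s\<^sup>2 < 1" using assms by (simp add: outer_def power2_less_1_iff abs_less_iff)
  show "s \<noteq> u" using assms speeds by (auto simp: outer_def)
  have "\<bar>s * u\<bar> < 1 * 1" unfolding abs_mult
    using assms u_bounds by (intro mult_strict_mono') (auto simp: outer_def)
  then show "1 - s * u > 0" by simp
qed

section \<open>Comparison of P and Q\<close>

definition "P s = W * (s - u) * (1 - s * u)"
definition "Q s = W * (s - u)\<^sup>2 + p * (1 - s\<^sup>2)"
definition "K = \<rho>\<^sup>2 / g + W\<^sup>2 * v\<^sup>2"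

lemma P: "A s - s * B s = P s" and Q: "s * A s - B s = Q s"
  by (simp_all add: A_def B_def P_def Q_def algebra_simps power2_eq_square)

text \<open>In terms of \<open>a\<close>, the left side is a positive multiple of
  \<open>\<rho> * p\<close> plus \<open>(a - 1) * (a - 2) * p\<^sup>2\<close>.\<close>

lemma enthalpy_ineq: "H\<^sup>2 - 2 * H * p - p * H / \<Gamma> + p\<^sup>2 - \<rho>\<^sup>2 > 0"
proof -
  define a where "a = \<Gamma> / (\<Gamma> - 1)"
  have a: "a \<ge> 2" "1 / \<Gamma> = 1 - 1 / a" using Gam by (simp_all add: a_def field_simps)
  have "a * (1 / a) = 1" using a by simp
  then have "H\<^sup>2 - 2 * H * p - p * H * (1 - 1 / a) + p\<^sup>2 - \<rho>\<^sup>2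
     = (2 * a - 3 + 1 / a) * (\<rho> * p) + (a - 1) * (a - 2) * p\<^sup>2"
    unfolding H_def a_def[symmetric] by algebra
  moreover have "(2 * a - 3 + 1 / a) * (\<rho> * p) > 0"
    using a rho pr by (intro mult_pos_pos add_pos_pos) auto
  moreover have "(a - 1) * (a - 2) * p\<^sup>2 \<ge> 0" using a by simp
  ultimately have "H\<^sup>2 - 2 * H * p - p * H * (1 / \<Gamma>) + p\<^sup>2 - \<rho>\<^sup>2 > 0" unfolding a(2) by linarith
  then show ?thesis by simp
qed

text \<open>Multiplication by \<open>g\<close> eliminates the tangential velocity. The outer
  condition bounds the remaining term in \<open>p\<^sup>2 * g\<close> by a multiple of
  \<open>(s - u)\<^sup>2\<close>, and \<open>enthalpy_ineq\<close> gives the sign of the total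
  coefficient.\<close>

lemma P_sq_minus_Q_sq_gt: assumes "outer s"
  shows "(1 - s\<^sup>2) * (K * (s - u)\<^sup>2) < (P s)\<^sup>2 - (Q s)\<^sup>2"
proof -
  define y2 where "y2 = (s - u)\<^sup>2"
  have y2: "y2 > 0" "\<sigma> * (1 - s\<^sup>2) \<le> y2" using outer[OF assms] by (auto simp: y2_def)
  have s1: "1 - s\<^sup>2 > 0" using outer[OF assms] by simp
  \<comment> \<open>As a multiple of \<sigma>, \<open>p\<^sup>2 * g\<close> lets the \<sigma> of the
    outer condition cancel.\<close>
  have pg: "p\<^sup>2 * g = \<sigma> * (p * H / \<Gamma> - p\<^sup>2)"
  proof -
    have "p * H / \<Gamma> * c2 = p\<^sup>2" using c2(3) Gam by (simp add: field_simps power2_eq_square)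
    then have "p\<^sup>2 * g * (1 - c2) = (p * H / \<Gamma> - p\<^sup>2) * (c2 * g)" by algebra
    also have "\<dots> = \<sigma> * (p * H / \<Gamma> - p\<^sup>2) * (1 - c2)" unfolding \<sigma>(2)[symmetric] by algebra
    finally show ?thesis using c2 by simp
  qed
  have "\<sigma> * (p\<^sup>2 * g * (1 - s\<^sup>2)) \<le> p\<^sup>2 * g * y2"
    using mult_left_mono[OF y2(2), of "p\<^sup>2 * g"] basic by (simp add: algebra_simps)
  also have "\<dots> = \<sigma> * ((p * H / \<Gamma> - p\<^sup>2) * y2)" unfolding pg by algebra
  finally have 1: "p\<^sup>2 * g * (1 - s\<^sup>2) \<le> (p * H / \<Gamma> - p\<^sup>2) * y2" using \<sigma> by simp
  have 2: "(H\<^sup>2 - 2 * H * p - p * H / \<Gamma> + p\<^sup>2 - \<rho>\<^sup>2) * y2 > 0" using enthalpy_ineq y2 by simp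
  have gK: "g * K = \<rho>\<^sup>2 + g * W\<^sup>2 * v\<^sup>2" using basic by (simp add: K_def field_simps)
  have "g * ((P s)\<^sup>2 - (Q s)\<^sup>2 - (1 - s\<^sup>2) * (K * y2))
      = (1 - s\<^sup>2) * (W * W * g * (1 - u\<^sup>2) * y2 - 2 * (W * g) * p * y2 - p\<^sup>2 * g * (1 - s\<^sup>2) - g * K * y2)"
    unfolding P_def Q_def y2_def by algebra
  also have "\<dots> = (1 - s\<^sup>2) * ((H\<^sup>2 - 2 * H * p - \<rho>\<^sup>2) * y2 - p\<^sup>2 * g * (1 - s\<^sup>2))"
    using gK basic(4) g_def by algebra
  also have "\<dots> > 0" using 1 2 s1 by (intro mult_pos_pos) (auto simp: algebra_simps)
  finally show ?thesis using basic(2) by (simp add: zero_less_mult_iff y2_def)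
qed

lemma K_pos: "K > 0"
  using rho basic by (simp add: K_def add_pos_nonneg)

lemma abs_Q_less: assumes "outer s" shows "\<bar>Q s\<bar> < \<bar>P s\<bar>"
proof -
  have "(1 - s\<^sup>2) * (K * (s - u)\<^sup>2) > 0" using outer[OF assms] K_pos by simp
  then have "(Q s)\<^sup>2 < (P s)\<^sup>2" using P_sq_minus_Q_sq_gt[OF assms] by linarith
  then show ?thesis by (intro power2_less_imp_less[of "\<bar>Q s\<bar>"]) simp_all
qed

lemma Q_pos: "outer s \<Longrightarrow> Q s > 0"
  using outer[of s] basic pr by (simp add: Q_def add_pos_pos)

lemma P_sgn: assumes "outer s" shows "P s * (s - u) > 0"
proof -
  have "P s * (s - u) = W * (1 - s * u) * (s - u)\<^sup>2" unfolding P_def by algebra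
  then show ?thesis using outer[OF assms] basic(3) by simp
qed

text \<open>In \<open>(1 - s\<^sup>2) * A s = P s - s * Q s\<close> the term \<open>P s\<close>
  dominates.\<close>

lemma A_sgn: assumes "outer s" shows "A s * (s - u) > 0"
proof -
  have s: "\<bar>s\<bar> < 1" "1 - s\<^sup>2 > 0" using assms outer[OF assms] by (auto simp: outer_def)
  have A: "(1 - s\<^sup>2) * A s = P s - s * Q s" unfolding P[symmetric] Q[symmetric] by algebra
  have "\<bar>s * Q s\<bar> < 1 * \<bar>P s\<bar>" unfolding abs_mult
    using s abs_Q_less[OF assms] by (intro mult_strict_mono') auto
  then have "(P s - s * Q s) * (s - u) > 0"
    using P_sgn[OF assms] by (auto simp: zero_less_mult_iff abs_if split: if_splits)
  then have "(1 - s\<^sup>2) * (A s * (s - u)) > 0" unfolding A[symmetric] by (simp add: algebra_simps)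
  then show ?thesis using s(2) by (simp add: zero_less_mult_iff)
qed

section \<open>Signs of the cross terms\<close>

text \<open>The sum and product of the two speeds turn both sides into expressions in \<sigma> and
  \<open>1 - u\<^sup>2\<close>. As \<open>g \<le> 1 - u\<^sup>2\<close>, it is then enough that
  \<open>1 + c2 < \<Gamma>\<close>.\<close>

lemma cross_ineq_min_max: "p * (1 - smin * smax) < W * (smax - u) * (u - smin)"
proof -
  define x where "x = 1 - u\<^sup>2"
  have x: "x > 0" "g \<le> x" using basic(5) by (simp_all add: x_def g_def)
  have prod: "(1 + \<sigma>) * (smin * smax) = u\<^sup>2 - \<sigma>" using speed_factor[of 0] by simp
  have 1: "(1 + \<sigma>) * (1 - smin * smax) = x + 2 * \<sigma>" using prod unfolding x_def by algebra
  have 2: "(1 + \<sigma>) * ((smax - u) * (u - smin)) = \<sigma> * x"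
    using prod speed_sum(1) unfolding x_def by algebra
  have "\<Gamma> * p = c2 * (W * g)" using c2(3) basic(4) by simp
  then have W: "W * \<sigma> * (1 - c2) = \<Gamma> * p" using \<sigma>(2) by algebra
  have "p * (x + 2 * \<sigma>) * (1 - c2) = p * (x * (1 - c2) + 2 * (c2 * g))" using \<sigma>(2) by algebra
  also have "\<dots> \<le> p * (x * (1 - c2) + 2 * (c2 * x))" using x c2 pr by simp
  also have "\<dots> = p * x * (1 + c2)" by algebra
  also have "\<dots> < p * x * \<Gamma>" using c2 pr x by simp
  also have "\<dots> = W * (\<sigma> * x) * (1 - c2)" using W by algebra
  finally have "p * (x + 2 * \<sigma>) < W * (\<sigma> * x)" using c2 by simp
  have "(1 + \<sigma>) * (p * (1 - smin * smax)) < (1 + \<sigma>) * (W * (smax - u) * (u - smin))"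
  proof -
    have "(1 + \<sigma>) * (p * (1 - smin * smax)) = p * (x + 2 * \<sigma>)" using 1 by algebra
    moreover have "(1 + \<sigma>) * (W * (smax - u) * (u - smin)) = W * (\<sigma> * x)" using 2 by algebra
    ultimately show ?thesis using \<open>p * (x + 2 * \<sigma>) < W * (\<sigma> * x)\<close> by argo
  qed
  moreover have "1 + \<sigma> > 0" using \<sigma>(1) by simp
  ultimately show ?thesis by (rule mult_left_less_imp_less[OF _ less_imp_le])
qed

text \<open>The left side minus the right is both \<open>a * A b - B b\<close> and
  \<open>b * A a - B a\<close>, the cross terms of the contact quadratic. Right minus left has slope
  \<open>- A b\<close> in \<open>a\<close> and \<open>- A a\<close> in \<open>b\<close>, so by
  \<open>A_sgn\<close> it only grows as the speeds move outwards.\<close>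

lemma cross_ineq:
  assumes "- 1 < a" "a \<le> smin" "smax \<le> b" "b < 1"
  shows "p * (1 - a * b) < W * (b - u) * (u - a)"
proof -
  have o: "outer b" "outer smin" using assms speeds by (auto simp: outer_def)
  have "A b > 0" using A_sgn[OF o(1)] assms speeds by (simp add: zero_less_mult_iff)
  then have "A b * (smin - a) \<ge> 0" using assms by simp
  moreover have "A smin < 0" using A_sgn[OF o(2)] speeds by (simp add: zero_less_mult_iff)
  then have "A smin * (b - smax) \<le> 0" using assms by (intro mult_nonpos_nonneg) simp_all
  moreover note cross_ineq_min_max
  moreover have "W * (b - u) * (u - a) - p * (1 - a * b)
     = W * (smax - u) * (u - smin) - p * (1 - smin * smax) - A smin * (b - smax) + A b * (smin - a)"
    unfolding A_def by algebra
  ultimately show ?thesis by linarith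
qed

section \<open>The intermediate state behind one wave\<close>

text \<open>With the transverse part split off, \<open>(E, m)\<close> is the intermediate state.  In terms of its data
  \<open>e\<^sub>0 = (A - r B) / (s - r)\<close> in the frame moving with the contact, \<open>E = (e\<^sub>0 + r\<^sup>2 ps) / (1 - r\<^sup>2)\<close> and
  \<open>m = r (e\<^sub>0 + ps) / (1 - r\<^sup>2)\<close>; \<open>X\<close> and \<open>Y\<close> in the proof are \<open>e\<^sub>0\<close> and \<open>ps\<close> up to a common factor.\<close>

lemma star:
  assumes o: "outer s" and r: "- 1 < r" "r < 1" and sgn: "(s - u) * (s - r) > 0"
  defines "ps \<equiv> (r * A s - B s) / (1 - s * r)"
  defines "E \<equiv> (A s + ps * r) / (s - r)" and "m \<equiv> (B s + ps) / (s - r)"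
  shows "E > 0" "m\<^sup>2 + K * ((s - u) / (s - r))\<^sup>2 < E\<^sup>2"
proof -
  define \<delta> \<kappa> where "\<delta> = s - r" "\<kappa> = 1 - s * r"
  define e where "e = 1 - r\<^sup>2"
  define X Y Z where "X = (A s - r * B s) * \<kappa>" "Y = \<delta> * (r * A s - B s)"
    "Z = A s * (1 - 2 * s * r + r\<^sup>2) + B s * (s - 2 * r + s * r\<^sup>2)"
  note d = \<delta>_\<kappa>_def e_def X_Y_Z_def
  have e: "e > 0" using r by (simp add: e_def power2_less_1_iff abs_less_iff)
  have s: "- 1 < s" "s < 1" "1 - s\<^sup>2 > 0" using o outer[OF o] by (auto simp: outer_def)
  have "\<bar>s * r\<bar> < 1 * 1" unfolding abs_mult using s r by (intro mult_strict_mono') auto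
  then have \<kappa>: "\<kappa> > 0" by (simp add: d)
  have \<delta>: "\<delta> \<noteq> 0" using sgn by (auto simp: d)
  have ps: "\<kappa> * ps = r * A s - B s" using \<kappa> by (simp add: ps_def d)
  have Ed: "\<delta> * E = A s + ps * r" and md: "\<delta> * m = B s + ps" using \<delta> by (simp_all add: E_def m_def d)
  have E: "\<delta> * \<kappa> * e * E = X + r\<^sup>2 * Y"
    using ps Ed unfolding d by algebra
  have m: "\<delta> * \<kappa> * e * m = r * (X + Y)"
    using ps md unfolding d by algebra
  have sum: "X + Y = e * P s" and diff: "X - Y = Z" unfolding P[symmetric] d by algebra+
  \<comment> \<open>The first square vanishes at the worst \<open>r\<close> and is dropped below;
    the rest depends on \<open>r\<close> only through \<open>\<kappa>\<^sup>2\<close>.\<close>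
  have PZ: "(1 - s\<^sup>2) * (P s * Z) = (P s * \<delta> - \<kappa> * Q s)\<^sup>2 + \<kappa>\<^sup>2 * ((P s)\<^sup>2 - (Q s)\<^sup>2)"
    unfolding P[symmetric] Q[symmetric] d by algebra
  have "(1 - s\<^sup>2) * (\<kappa>\<^sup>2 * (K * (s - u)\<^sup>2)) = \<kappa>\<^sup>2 * ((1 - s\<^sup>2) * (K * (s - u)\<^sup>2))" by algebra
  also have "\<dots> < \<kappa>\<^sup>2 * ((P s)\<^sup>2 - (Q s)\<^sup>2)" using P_sq_minus_Q_sq_gt[OF o] \<kappa> by simp
  also have "\<dots> \<le> (1 - s\<^sup>2) * (P s * Z)" unfolding PZ by simp
  finally have *: "\<kappa>\<^sup>2 * (K * (s - u)\<^sup>2) < P s * Z" using s by simp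
  then have PZ0: "P s * Z > 0" using K_pos by (smt (verit) mult_nonneg_nonneg zero_le_power2)
  have "\<delta> * P s > 0" using P_sgn[OF o] sgn by (auto simp: d zero_less_mult_iff)
  then have pos: "\<delta> * (X + Y) > 0" "\<delta> * (X - Y) > 0"
    using PZ0 e unfolding sum diff by (auto simp: zero_less_mult_iff mult_less_0_iff)
  \<comment> \<open>\<open>Y\<close> has no known sign, since the contact pressure may be negative;
    \<open>E\<close> is therefore written as a positive combination of \<open>X + Y\<close> and
    \<open>X - Y\<close>.\<close>
  have "2 * (\<delta>\<^sup>2 * \<kappa> * e * E) = (1 + r\<^sup>2) * (\<delta> * (X + Y)) + e * (\<delta> * (X - Y))"
    using E unfolding e_def by algebra
  also have "\<dots> > 0" using pos e by (intro add_pos_pos[OF mult_pos_pos mult_pos_pos] pos e) (simp add: add_pos_nonneg)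
  finally have "\<delta>\<^sup>2 * \<kappa> * e * E > 0" by (rule zero_less_mult_pos) simp
  then show "E > 0" by (rule zero_less_mult_pos) (use \<delta> \<kappa> e in simp)
  have "(\<delta> * \<kappa> * e)\<^sup>2 * (E\<^sup>2 - m\<^sup>2) = (X + r\<^sup>2 * Y)\<^sup>2 - (r * (X + Y))\<^sup>2"
    unfolding E[symmetric] m[symmetric] by algebra
  also have "\<dots> = e * (X + Y) * (X - Y) + e\<^sup>2 * Y\<^sup>2"
    unfolding e_def by algebra
  also have "\<dots> = e\<^sup>2 * (P s * Z) + e\<^sup>2 * Y\<^sup>2" unfolding sum diff by algebra
  also have "\<dots> \<ge> e\<^sup>2 * (P s * Z)" by simp
  finally have "e\<^sup>2 * (P s * Z) \<le> (\<delta> * \<kappa> * e)\<^sup>2 * (E\<^sup>2 - m\<^sup>2)" .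
  moreover have "e\<^sup>2 * (\<kappa>\<^sup>2 * (K * (s - u)\<^sup>2)) < e\<^sup>2 * (P s * Z)" using * e by simp
  moreover have "e\<^sup>2 * (\<kappa>\<^sup>2 * (K * (s - u)\<^sup>2)) = (\<delta> * \<kappa> * e)\<^sup>2 * (K * ((s - u) / (s - r))\<^sup>2)"
    using \<delta> unfolding d(1)[symmetric] by (simp add: power_mult_distrib power_divide)
  ultimately have "(\<delta> * \<kappa> * e)\<^sup>2 * (K * ((s - u) / (s - r))\<^sup>2) < (\<delta> * \<kappa> * e)\<^sup>2 * (E\<^sup>2 - m\<^sup>2)" by linarith
  then show "m\<^sup>2 + K * ((s - u) / (s - r))\<^sup>2 < E\<^sup>2" using \<delta> \<kappa> e by simp
qed

end

section \<open>The HLLC solver\<close>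

text \<open>Carries a planar state over to the scalar locale \<open>fluid\<close> through its
  velocity components along \<open>n\<close> and \<tau>.\<close>

locale fluid_state =
  fixes \<Gamma> \<rho> p :: real and w n \<tau> :: "real ^ 2"
  assumes \<Gamma>: "1 < \<Gamma>" "\<Gamma> \<le> 2" and phys: "physical (\<rho>, w, p)"
    and orthonormal: "norm n = 1" "norm \<tau> = 1" "\<tau> \<bullet> n = 0"
begin

lemma norm_w: "(norm w)\<^sup>2 = (w \<bullet> n)\<^sup>2 + (w \<bullet> \<tau>)\<^sup>2"
  using norm_orthonormal_2[OF orthonormal] .

sublocale fluid \<Gamma> \<rho> p "w \<bullet> n" "w \<bullet> \<tau>"
  using \<Gamma> phys norm_w[symmetric] by unfold_locales (simp_all add: physical_def power_less_one_iff)

abbreviation "U \<equiv> state_of_prim \<Gamma> (\<rho>, w, p)"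

lemma prims: "velocity \<Gamma> U = w" "pressure \<Gamma> U = p" "rest_density \<Gamma> U = \<rho>"
    "normal_velocity \<Gamma> n U = w \<bullet> n"
  using prim_state_of_prim[OF \<Gamma> phys]
  by (simp_all add: velocity_def pressure_def rest_density_def normal_velocity_def)

lemma lorentz: "lorentz w = 1 / sqrt g" "(lorentz w)\<^sup>2 = 1 / g"
  using basic(2) by (simp_all add: lorentz_def norm_w g_def power_divide diff_diff_eq)

lemma enthalpy: "\<rho> * enthalpy \<Gamma> \<rho> p = H"
  using rho \<Gamma> by (simp add: enthalpy_def H_def field_simps)

lemma conserved: "mass U = \<rho> / sqrt g" "momentum U = W *\<^sub>R w" "energy U = W - p"
proof -
  have "\<rho> * lorentz w * enthalpy \<Gamma> \<rho> p * lorentz w = \<rho> * enthalpy \<Gamma> \<rho> p * (lorentz w)\<^sup>2"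
    by algebra
  also have "\<dots> = W" unfolding enthalpy lorentz(2) W_def by simp
  finally show "momentum U = W *\<^sub>R w" "energy U = W - p"
    by (simp_all add: state_of_prim_def momentum_def energy_def Let_def)
  show "mass U = \<rho> / sqrt g" by (simp add: state_of_prim_def mass_def Let_def lorentz(1))
qed

lemma sigma_s: "sigma_s \<Gamma> U = \<sigma>"
proof -
  have "(sound_speed \<Gamma> U)\<^sup>2 = c2"
    using c2(1) unfolding sound_speed_def prims enthalpy c2_def by simp
  then show ?thesis using basic(2) by (simp add: sigma_s_def prims lorentz(2) \<sigma>_def)
qed

lemma wave_speeds: "s_min \<Gamma> n U = smin" "s_max \<Gamma> n U = smax"
  by (simp_all add: s_min_def s_max_def smin_def smax_def Let_def prims sigma_s)

lemma hllc_AB: "hllc_A n s U = A s" "hllc_B \<Gamma> n s U = B s"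
  by (simp_all add: hllc_A_def hllc_B_def A_def B_def conserved prims)

text \<open>Mass and tangential momentum are scaled by the same factor, so their squares add up to
  the \<open>K\<close> term of \<open>star\<close>.\<close>

lemma star_state_admissible:
  assumes "outer s" "- 1 < r" "r < 1" "(s - w \<bullet> n) * (s - r) > 0"
    and ps: "ps = (r * A s - B s) / (1 - s * r)"
  shows "star_state \<Gamma> n \<tau> s r ps U \<in> admissible \<Gamma>"
proof -
  define x where "x = (s - w \<bullet> n) / (s - r)"
  define E m t D where "E = (A s + ps * r) / (s - r)" "m = (B s + ps) / (s - r)"
    "t = W * (w \<bullet> \<tau>) * x" "D = \<rho> / sqrt g * x"
  note d = this
  have st: "star_state \<Gamma> n \<tau> s r ps U = (D, m *\<^sub>R n + t *\<^sub>R \<tau>, E)"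
    by (simp add: star_state_def Let_def conserved prims d x_def A_def B_def algebra_simps)
  have bounds: "E > 0" "m\<^sup>2 + K * x\<^sup>2 < E\<^sup>2"
    using star[OF assms(1-4)] by (simp_all add: d ps x_def)
  have nn: "n \<bullet> n = 1" "\<tau> \<bullet> \<tau> = 1" "n \<bullet> \<tau> = 0"
    using orthonormal by (simp_all add: norm_eq_1 inner_commute)
  have "(norm (m *\<^sub>R n + t *\<^sub>R \<tau>))\<^sup>2 = m\<^sup>2 + t\<^sup>2"
    unfolding norm_orthonormal_2[OF orthonormal] using nn orthonormal(3) by (simp add: inner_add_left)
  moreover have "D\<^sup>2 + t\<^sup>2 = K * x\<^sup>2"
    using basic(2) by (simp add: d K_def power_mult_distrib power_divide distrib_right)
  ultimately have "D\<^sup>2 + (norm (m *\<^sub>R n + t *\<^sub>R \<tau>))\<^sup>2 < E\<^sup>2" using bounds(2) by linarith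
  moreover have "x > 0"
    using assms(4) by (auto simp: x_def zero_less_mult_iff zero_less_divide_iff)
  then have "D > 0" using rho basic(2) by (simp add: d)
  ultimately show ?thesis unfolding st using bounds(1) \<Gamma> by (intro admissible_sufficient)
qed

end

section \<open>Location of the contact speed and conclusion\<close>

theorem theorem3p2:
  fixes \<Gamma> sm sp :: real and n \<tau> :: "real ^ 2" and Um Up :: state
  assumes "1 < \<Gamma>" and "\<Gamma> \<le> 2"
    and "norm n = 1"
    and "norm \<tau> = 1" and "\<tau> \<bullet> n = 0"
    and "Um \<in> admissible \<Gamma>" and "Up \<in> admissible \<Gamma>"
    and "sm = min (s_min \<Gamma> n Um) (s_min \<Gamma> n Up)"
    and "sp = max (s_max \<Gamma> n Um) (s_max \<Gamma> n Up)"
  shows "hllc_minus \<Gamma> n \<tau> sm sp Um Up \<in> admissible \<Gamma>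
       \<and> hllc_plus \<Gamma> n \<tau> sm sp Um Up \<in> admissible \<Gamma>"
proof -
  obtain \<rho> w p where L: "physical (\<rho>, w, p)" "Um = state_of_prim \<Gamma> (\<rho>, w, p)"
    using assms(6) by (auto simp: admissible_def)
  obtain \<rho>' w' p' where R: "physical (\<rho>', w', p')" "Up = state_of_prim \<Gamma> (\<rho>', w', p')"
    using assms(7) by (auto simp: admissible_def)
  interpret L: fluid_state \<Gamma> \<rho> p w n \<tau> using assms L by unfold_locales
  interpret R: fluid_state \<Gamma> \<rho>' p' w' n \<tau> using assms R by unfold_locales
  have sm: "- 1 < sm" "sm < 1" "sm \<le> L.smin" "sm \<le> R.smin"
    and sp: "- 1 < sp" "sp < 1" "L.smax \<le> sp" "R.smax \<le> sp" and "sm < sp"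
    using L.speeds R.speeds unfolding assms(8,9) L(2) R(2) L.wave_speeds R.wave_speeds by linarith+
  have outer: "L.outer sm" "L.outer sp" "R.outer sm" "R.outer sp"
    using sm sp by (simp_all add: L.outer_def R.outer_def)
  have "\<bar>sm * x\<bar> < 1 * 1" "\<bar>sp * x\<bar> < 1 * 1" if "- 1 < x" "x < 1" for x
    unfolding abs_mult using sm sp that by (intro mult_strict_mono'; simp)+
  then have one: "1 - sm * x > 0" "1 - sp * x > 0" if "- 1 < x" "x < 1" for x
    using that by (simp_all add: abs_less_iff)
  define f where "f x = hllc_C0 \<Gamma> n sm sp Um Up + hllc_C1 \<Gamma> n sm sp Um Up * x
      + hllc_C2 n sm sp Um Up * x\<^sup>2" for x
  \<comment> \<open>At a root the two expressions for the contact pressure agree after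
    cross-multiplication.\<close>
  have f: "f x = (x * L.A sm - L.B sm) * (1 - sp * x) - (x * R.A sp - R.B sp) * (1 - sm * x)" for x
    unfolding f_def hllc_C0_def hllc_C1_def hllc_C2_def L(2) R(2) L.hllc_AB R.hllc_AB by algebra
  \<comment> \<open>At \<open>sm\<close> the left state contributes its \<open>Q\<close> and the
    right state a cross term; at \<open>sp\<close> the roles are exchanged.\<close>
  have "L.Q sm * (1 - sp * sm) > 0" using L.Q_pos outer one sm by simp
  moreover have "sm * R.A sp - R.B sp < 0"
    using R.cross_ineq[of sm sp] sm sp by (simp add: R.A_def R.B_def algebra_simps)
  then have "(sm * R.A sp - R.B sp) * (1 - sm * sm) < 0" using one sm by (simp add: mult_neg_pos)
  ultimately have fm: "f sm > 0" unfolding f L.Q by linarith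
  have "R.Q sp * (1 - sm * sp) > 0" using R.Q_pos outer one sp by simp
  moreover have "sp * L.A sm - L.B sm < 0"
    using L.cross_ineq[of sm sp] sm sp by (simp add: L.A_def L.B_def algebra_simps)
  then have "(sp * L.A sm - L.B sm) * (1 - sp * sp) < 0" using one sp by (simp add: mult_neg_pos)
  ultimately have fp: "f sp < 0" unfolding f R.Q by linarith
  define r where "r = contact_speed \<Gamma> n sm sp Um Up"
  define ps where "ps = contact_pressure \<Gamma> n sm sp Um Up"
  have r: "sm < r" "r < sp" "f r = 0"
    using quadratic_root_between[OF \<open>sm < sp\<close> fm[unfolded f_def] fp[unfolded f_def]]
    unfolding r_def contact_speed_def Let_def f_def by auto
  then have r1: "- 1 < r" "r < 1" using sm sp by auto
  have psm: "ps = (r * L.A sm - L.B sm) / (1 - sm * r)"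
    unfolding ps_def contact_pressure_def Let_def r_def[symmetric] unfolding L(2) L.hllc_AB ..
  have "ps = (r * hllc_A n sp Up - hllc_B \<Gamma> n sp Up) / (1 - sp * r)"
    unfolding ps_def using contact_pressure_plus[OF r_def r(3)[unfolded f_def]] one[OF r1] by simp
  then have psp: "ps = (r * R.A sp - R.B sp) / (1 - sp * r)" unfolding R(2) R.hllc_AB .
  have "(sm - w \<bullet> n) * (sm - r) > 0"
    using r sm L.speeds by (intro mult_neg_neg) auto
  then have "star_state \<Gamma> n \<tau> sm r ps Um \<in> admissible \<Gamma>"
    unfolding L(2) using L.star_state_admissible[OF outer(1) r1 _ psm] by blast
  moreover have "(sp - w' \<bullet> n) * (sp - r) > 0"
    using r sp R.speeds by (intro mult_pos_pos) auto
  then have "star_state \<Gamma> n \<tau> sp r ps Up \<in> admissible \<Gamma>"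
    unfolding R(2) using R.star_state_admissible[OF outer(4) r1 _ psp] by blast
  ultimately show ?thesis unfolding hllc_minus_def hllc_plus_def r_def ps_def ..
qed

end
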